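(* Let $D$ be a Seymour orientation and let $X\subseteq V(D)$ be such that all vertices in $V(D)\setminus X$ are uniform on $X$. Let $H$ be an orientation with vertex set $X$ satisfying $$|N_1(H,x)|-|N_2(H,x)|\ \ge\ |N_1(D|_X,x)|-|N_2(D|_X,x)|\quad\text{for all } x\in X,$$ and let $D'$ be the orientation obtained from $D$ by replacing the induced digraph on the vertices of $X$ by $H$. Then $D'$ is a Seymour orientation. Further, if $D$, $D|_X$ and $H$ are all Seymour-tight orientations, then $D'$ is also Seymour-tight.
   Context: All directed graphs are finite, without loops or multiple arcs. An orientation is a directed graph with no directed cycle of length 2. For a directed graph $G$ and $v\in V(G)$, $N_1(G,v)=\{w : (v,w)\in E(G)\}$ and $N_2(G,v)=\{w\in V(G)\setminus(N_1(G,v)\cup\{v\}) : \exists u\in N_1(G,v),\ (u,w)\in E(G)\}$. An orientation $G$ is a Seymour orientation if $|N_1(G,v)|\ge|N_2(G,v)|$ for all $v\in V(G)$, and Seymour-tight if $|N_1(G,v)|=|N_2(G,v)|$ for all $v\in V(G)$. $D|_X$ denotes the subdigraph of $D$ induced by $X$. A vertex $v\in V(D)\setminus X$ is uniform on $X$ if one of the following holds: (a) all vertices of $X$ are in-neighbours of $v$; (b) all vertices of $X$ are out-neighbours of $v$; (c) no vertex of $X$ is an in- or out-neighbour of $v$. In $D'$, which has vertex set $V(D)$, the arcs with at least one endpoint outside $X$ are those of $D$, and the arcs with both endpoints in $X$ are those of $H$. *)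

theory Defs
  imports "Graph_Theory.Digraph_Component" "Graph_Theory.Pair_Digraph"
begin

text \<open>
  The locale \<^locale>\<open>digraph\<close> is that of finite digraphs without loops and multiple arcs.
  The vertex set may be empty.
\<close>

definition orientation :: "('a, 'b) pre_digraph \<Rightarrow> bool" where
  "orientation G \<longleftrightarrow> digraph G \<and> (\<forall>u v. \<not> (u \<rightarrow>\<^bsub>G\<^esub> v \<and> v \<rightarrow>\<^bsub>G\<^esub> u))"

definition N1 :: "('a, 'b) pre_digraph \<Rightarrow> 'a \<Rightarrow> 'a set" where
  "N1 G v = {w. v \<rightarrow>\<^bsub>G\<^esub> w}"

definition N2 :: "('a, 'b) pre_digraph \<Rightarrow> 'a \<Rightarrow> 'a set" where
  "N2 G v = {w \<in> verts G - (N1 G v \<union> {v}). \<exists>u \<in> N1 G v. u \<rightarrow>\<^bsub>G\<^esub> w}"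

definition seymour_orientation :: "('a, 'b) pre_digraph \<Rightarrow> bool" where
  "seymour_orientation G \<longleftrightarrow>
     orientation G \<and> (\<forall>v \<in> verts G. card (N1 G v) \<ge> card (N2 G v))"

definition seymour_tight :: "('a, 'b) pre_digraph \<Rightarrow> bool" where
  "seymour_tight G \<longleftrightarrow>
     orientation G \<and> (\<forall>v \<in> verts G. card (N1 G v) = card (N2 G v))"

definition uniform_on :: "('a, 'b) pre_digraph \<Rightarrow> 'a set \<Rightarrow> 'a \<Rightarrow> bool" where
  "uniform_on G X v \<longleftrightarrow> v \<in> verts G - X \<and>
     ((\<forall>x \<in> X. x \<rightarrow>\<^bsub>G\<^esub> v) \<or>
      (\<forall>x \<in> X. v \<rightarrow>\<^bsub>G\<^esub> x) \<or>
      (\<forall>x \<in> X. \<not> x \<rightarrow>\<^bsub>G\<^esub> v \<and> \<not> v \<rightarrow>\<^bsub>G\<^esub> x))"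

text \<open>
  Replacing the subdigraph of \<open>D\<close> induced by \<open>X\<close> mixes arcs of two digraphs, so it is defined for
  digraphs whose arcs are pairs of vertices. It is meant for \<open>H\<close> well-formed with vertex set \<open>X\<close>,
  so that all arcs of \<open>H\<close> have both ends in \<open>X\<close>.
\<close>

definition replace_induced ::
  "'a pair_pre_digraph \<Rightarrow> 'a set \<Rightarrow> 'a pair_pre_digraph \<Rightarrow> 'a pair_pre_digraph" where
  "replace_induced D X H =
     \<lparr> pverts = pverts D,
       parcs = {(u, v) \<in> parcs D. u \<notin> X \<or> v \<notin> X} \<union> parcs H \<rparr>"

end

(* The arcs meeting the outside of X, and hence the uniformity of outside vertices, do not depend on
   what X induces. For v outside X, both neighbourhoods are unchanged. For v in X, a vertex outside
   X dominated by some vertex of X is dominated by v itself, and an out-neighbour of v outside X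
   dominates nothing in X; so paths of length 2 from v to second neighbours stay inside X or
   leave X at once, and N1 and N2 split into the part inside X and a part that does not see the
   digraph induced on X. *)
theory Submission
  imports Defs
begin

text \<open>The remaining digraph axioms come for free: arcs that are pairs cannot be multiple,
  asymmetry with \<open>u = v\<close> excludes loops, and finitely many vertices leave finitely many
  arcs.\<close>

lemma orientation_with_proj_iff:
  "orientation (with_proj G) \<longleftrightarrow> finite (pverts G) \<and> parcs G \<subseteq> pverts G \<times> pverts G \<and>
     (\<forall>u v. \<not> ((u, v) \<in> parcs G \<and> (v, u) \<in> parcs G))" (is "?L \<longleftrightarrow> ?R")
proof
  assume L: ?L
  then interpret digraph "with_proj G" by (simp add: orientation_def)
  from L show ?R
    using wellformed finite_verts by (auto simp: orientation_def)
next
  assume R: ?R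
  then have "finite (parcs G)" by (meson finite_SigmaI finite_subset)
  with R have "digraph (with_proj G)"
    by unfold_locales (auto simp: arc_to_ends_def, blast)
  with R show ?L by (auto simp: orientation_def)
qed

lemma N1_with_proj: "N1 (with_proj G) v = {w. (v, w) \<in> parcs G}"
  by (simp add: N1_def)

lemma N2_with_proj:
  "N2 (with_proj G) v =
     {w \<in> pverts G. w \<noteq> v \<and> (v, w) \<notin> parcs G \<and> (\<exists>u. (v, u) \<in> parcs G \<and> (u, w) \<in> parcs G)}"
  by (auto simp: N2_def N1_def)

lemma orientation_finite_N2:
  assumes "orientation G"
  shows "finite (N2 G v)"
proof -
  interpret digraph G using assms by (simp add: orientation_def)
  show ?thesis by (rule finite_subset[OF _ finite_verts]) (auto simp: N2_def)
qed

lemma orientation_finite_N1: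
  assumes "orientation G"
  shows "finite (N1 G v)"
proof -
  interpret digraph G using assms by (simp add: orientation_def)
  show ?thesis by (rule finite_subset[OF _ finite_verts]) (auto simp: N1_def)
qed

lemma with_proj_induce_subgraph:
  "with_proj D \<restriction> X = with_proj \<lparr>pverts = X, parcs = {(u, v) \<in> parcs D. u \<in> X \<and> v \<in> X}\<rparr>"
  by (auto simp: induce_subgraph_def with_proj_def)

lemma replace_induced_restrict:
  assumes "orientation (with_proj H)" and "pverts H = X"
  shows "with_proj (replace_induced D X H) \<restriction> X = with_proj H"
proof -
  have arcs: "{(u, v) \<in> parcs (replace_induced D X H). u \<in> X \<and> v \<in> X} = parcs H"
    using assms by (auto simp: replace_induced_def orientation_with_proj_iff)
  show ?thesis
    unfolding with_proj_induce_subgraph arcs using assms(2) by (simp add: with_proj_def)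
qed

lemma parcs_replace_induced_outside:
  assumes "orientation (with_proj H)" and "pverts H = X" and "u \<notin> X \<or> v \<notin> X"
  shows "(u, v) \<in> parcs (replace_induced D X H) \<longleftrightarrow> (u, v) \<in> parcs D"
  using assms by (auto simp: replace_induced_def orientation_with_proj_iff)

lemma orientation_replace_induced:
  assumes "orientation (with_proj D)" and "X \<subseteq> pverts D"
    and "orientation (with_proj H)" and "pverts H = X"
  shows "orientation (with_proj (replace_induced D X H))"
  using assms unfolding orientation_with_proj_iff replace_induced_def by auto

text \<open>Uniformity of \<open>v\<close> only concerns arcs with the end \<open>v\<close> outside
  \<open>X\<close>. This makes the splitting of neighbourhoods below available for the new digraph
  as well as for \<open>D\<close>.\<close>

lemma uniform_on_replace_induced:
  assumes "orientation (with_proj H)" and "pverts H = X"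
  shows "uniform_on (with_proj (replace_induced D X H)) X v \<longleftrightarrow> uniform_on (with_proj D) X v"
  using parcs_replace_induced_outside[OF assms, of _ v D]
    parcs_replace_induced_outside[OF assms, of v _ D]
  by (auto simp: uniform_on_def replace_induced_def)

lemma card_N1_split:
  assumes "orientation G" and "v \<in> X"
  shows "card (N1 G v) = card (N1 (G \<restriction> X) v) + card (N1 G v - X)"
proof -
  have "N1 (G \<restriction> X) v = N1 G v \<inter> X"
    using assms(2) by (auto simp: N1_def arcs_ends_def arc_to_ends_def)
  then show ?thesis
    using card_Int_Diff[OF orientation_finite_N1[OF assms(1)]] by simp
qed

text \<open>The last summand involves only arcs with an end outside \<open>X\<close>, so digraphs
  that differ only inside \<open>X\<close> share it.\<close>

lemma card_N2_split:
  assumes "orientation G" and "X \<subseteq> verts G" and "\<forall>w \<in> verts G - X. uniform_on G X w" and "v \<in> X"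
  shows "card (N2 G v) = card (N2 (G \<restriction> X) v)
    + card {w \<in> verts G - X - N1 G v. \<exists>u \<in> N1 G v - X. u \<rightarrow>\<^bsub>G\<^esub> w}"
proof -
  interpret digraph G using assms(1) by (simp add: orientation_def)
  have asym: "\<not> (u \<rightarrow>\<^bsub>G\<^esub> w \<and> w \<rightarrow>\<^bsub>G\<^esub> u)" for u w
    using assms(1) by (simp add: orientation_def)
  have sub: "u \<rightarrow>\<^bsub>G \<restriction> X\<^esub> w \<longleftrightarrow> u \<rightarrow>\<^bsub>G\<^esub> w \<and> u \<in> X \<and> w \<in> X" for u w
    by (auto simp: arcs_ends_def arc_to_ends_def)
  \<comment> \<open>One arc from \<open>X\<close> to \<open>w\<close> rules out two of the three
    cases of uniformity, one of them by asymmetry; hence all of \<open>X\<close> dominates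
    \<open>w\<close>.\<close>
  have out: "x \<rightarrow>\<^bsub>G\<^esub> w \<longleftrightarrow> v \<rightarrow>\<^bsub>G\<^esub> w" if "x \<in> X" "w \<in> verts G - X" for x w
    using assms(3,4) that asym unfolding uniform_on_def by blast
  \<comment> \<open>By \<open>out\<close>, all of \<open>X\<close> dominates \<open>u\<close>, so an
    arc from \<open>u\<close> back into \<open>X\<close> would close a 2-cycle.\<close>
  have leave: "u \<notin> X \<Longrightarrow> v \<rightarrow>\<^bsub>G\<^esub> u \<Longrightarrow> u \<rightarrow>\<^bsub>G\<^esub> w \<Longrightarrow> w \<notin> X" for u w
    using out asym adj_in_verts(2) by blast
  have "N2 G v \<inter> X = N2 (G \<restriction> X) v"
    using assms(2,4) leave by (auto simp: N2_def N1_def sub)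
  \<comment> \<open>A middle vertex in \<open>X\<close> would, by \<open>out\<close>, make
    \<open>w\<close> a first neighbour of \<open>v\<close>.\<close>
  moreover have "N2 G v - X = {w \<in> verts G - X - N1 G v. \<exists>u \<in> N1 G v - X. u \<rightarrow>\<^bsub>G\<^esub> w}"
    using assms(4) out by (auto simp: N2_def N1_def)
  ultimately show ?thesis
    using card_Int_Diff[OF orientation_finite_N2[OF assms(1)], of v X] by simp
qed

lemma replace_induced_neighbourhoods_outside:
  assumes "orientation (with_proj D)" and "orientation (with_proj H)" and "pverts H = X"
    and "uniform_on (with_proj D) X v"
  shows "N1 (with_proj (replace_induced D X H)) v = N1 (with_proj D) v"
    and "N2 (with_proj (replace_induced D X H)) v = N2 (with_proj D) v"
proof -
  note outside = parcs_replace_induced_outside[OF assms(2,3)]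
  have v: "v \<notin> X" using assms(4) by (simp add: uniform_on_def)
  have N1: "(v, w) \<in> parcs (replace_induced D X H) \<longleftrightarrow> (v, w) \<in> parcs D" for w
    using outside v by simp
  then show "N1 (with_proj (replace_induced D X H)) v = N1 (with_proj D) v"
    by (simp add: N1_with_proj)
  have "(u, w) \<in> parcs (replace_induced D X H) \<longleftrightarrow> (u, w) \<in> parcs D"
    if "(v, w) \<notin> parcs D" "(v, u) \<in> parcs D" for u w
  proof -
    \<comment> \<open>If both were in \<open>X\<close>, then by uniformity and asymmetry the arc
      from \<open>v\<close> to \<open>u\<close> would force one from \<open>v\<close> to
      \<open>w\<close>.\<close>
    have "u \<notin> X \<or> w \<notin> X"
      using assms(1,4) that unfolding uniform_on_def orientation_with_proj_iff
      by auto
    then show ?thesis using outside by blast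
  qed
  then show "N2 (with_proj (replace_induced D X H)) v = N2 (with_proj D) v"
    unfolding N2_with_proj N1 by (auto simp: replace_induced_def)
qed

text \<open>In \<open>D\<close> and in \<open>D'\<close> the parts of the neighbourhoods outside
  \<open>X\<close> are the same sets, so their sizes cancel. Having an equality, over the integers,
  serves both the Seymour and the tight case.\<close>

lemma replace_induced_card_diff:
  fixes D H :: "'a pair_pre_digraph"
  assumes "orientation (with_proj D)" and "X \<subseteq> pverts D"
    and "\<forall>w \<in> pverts D - X. uniform_on (with_proj D) X w"
    and "orientation (with_proj H)" and "pverts H = X" and "v \<in> X"
  defines "D' \<equiv> with_proj (replace_induced D X H)"
  shows "int (card (N1 D' v)) - int (card (N2 D' v))
      - (int (card (N1 (with_proj H) v)) - int (card (N2 (with_proj H) v)))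
    = int (card (N1 (with_proj D) v)) - int (card (N2 (with_proj D) v))
      - (int (card (N1 (with_proj D \<restriction> X) v)) - int (card (N2 (with_proj D \<restriction> X) v)))"
proof -
  have verts: "verts D' = pverts D" by (simp add: D'_def replace_induced_def)
  have ori: "orientation D'"
    unfolding D'_def using assms(1,2,4,5) by (rule orientation_replace_induced)
  have uni: "\<forall>w \<in> verts D' - X. uniform_on D' X w"
    using assms(3) uniform_on_replace_induced[OF assms(4,5)] verts by (simp add: D'_def)
  have induced: "D' \<restriction> X = with_proj H"
    unfolding D'_def using assms(4,5) by (rule replace_induced_restrict)
  note outside = parcs_replace_induced_outside[OF assms(4,5)]
  have N1: "N1 D' v - X = N1 (with_proj D) v - X"
    using outside by (auto simp: D'_def N1_with_proj)
  have N2: "{w \<in> verts D' - X - N1 D' v. \<exists>u \<in> N1 D' v - X. u \<rightarrow>\<^bsub>D'\<^esub> w}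
      = {w \<in> verts (with_proj D) - X - N1 (with_proj D) v.
          \<exists>u \<in> N1 (with_proj D) v - X. u \<rightarrow>\<^bsub>with_proj D\<^esub> w}"
    unfolding N1 verts using outside by (auto simp: D'_def N1_with_proj)
  show ?thesis
    using card_N1_split[OF ori assms(6), unfolded induced N1] card_N1_split[OF assms(1,6)]
      card_N2_split[OF ori _ uni assms(6), unfolded induced N2] card_N2_split[OF assms(1) _ _ assms(6)]
      assms(2,3) verts
    by simp
qed

theorem lemma4p2:
  fixes D H :: "'a pair_pre_digraph" and X :: "'a set"
  assumes "seymour_orientation (with_proj D)"
    and "X \<subseteq> pverts D"
    and "\<forall>v \<in> pverts D - X. uniform_on (with_proj D) X v"
    and "orientation (with_proj H)"
    and "pverts H = X"
    and "\<forall>x \<in> X.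
      int (card (N1 (with_proj H) x)) - int (card (N2 (with_proj H) x))
      \<ge> int (card (N1 (with_proj D \<restriction> X) x)) - int (card (N2 (with_proj D \<restriction> X) x))"
  shows "seymour_orientation (with_proj (replace_induced D X H)) \<and>
    (seymour_tight (with_proj D) \<and> seymour_tight (with_proj D \<restriction> X) \<and> seymour_tight (with_proj H)
      \<longrightarrow> seymour_tight (with_proj (replace_induced D X H)))"
proof -
  have ori: "orientation (with_proj D)"
    and seymour: "\<And>v. v \<in> pverts D \<Longrightarrow> card (N2 (with_proj D) v) \<le> card (N1 (with_proj D) v)"
    using assms(1) by (auto simp: seymour_orientation_def)
  let ?D' = "with_proj (replace_induced D X H)"
  have ori': "orientation ?D'"
    using ori assms(2,4,5) by (rule orientation_replace_induced)
  have verts: "verts ?D' = pverts D" by (simp add: replace_induced_def)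
  note inside = replace_induced_card_diff[OF ori assms(2-5)]
  note outside = replace_induced_neighbourhoods_outside[OF ori assms(4,5)]
  have "card (N2 ?D' v) \<le> card (N1 ?D' v)" if v: "v \<in> pverts D" for v
  proof (cases "v \<in> X")
    case True
    \<comment> \<open>The excess of first over second neighbours at \<open>v\<close> is its value in
      \<open>D\<close>, which is nonnegative, plus the gain from passing to \<open>H\<close>,
      nonnegative by hypothesis.\<close>
    then show ?thesis using inside[OF True] seymour[OF v] assms(6) by fastforce
  next
    case False
    then show ?thesis using outside assms(3) seymour v by simp
  qed
  moreover have "card (N1 ?D' v) = card (N2 ?D' v)"
    if v: "v \<in> pverts D" and "seymour_tight (with_proj D)" "seymour_tight (with_proj D \<restriction> X)"
      "seymour_tight (with_proj H)" for v
  proof (cases "v \<in> X")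
    case True
    \<comment> \<open>Tightness makes the three known differences in \<open>inside\<close> vanish,
      hence also the fourth.\<close>
    then show ?thesis using inside[OF True] that assms(5) by (simp add: seymour_tight_def)
  next
    case False
    then show ?thesis using outside assms(3) that by (simp add: seymour_tight_def)
  qed
  ultimately show ?thesis
    using ori' verts by (simp add: seymour_orientation_def seymour_tight_def)
qed

end
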